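(* Let $p\ge1$ and $k>1$ be fixed integers. Let $\Theta$ be the set of pairs $\theta=(P,\boldsymbol{\gamma})$, where $P$ is a probability distribution on $\mathbb{R}^p$ and $\boldsymbol{\gamma}=(\gamma_1,\gamma_2,\ldots)\in\{1,\ldots,k\}^{\mathbb{N}}$, satisfying the following three assumptions (notation as defined in the context): (a) $E_P\|\mathbf{X}\|^2<\infty$, and the minimiser $W(P)=(\boldsymbol{\mu}_1^*,\ldots,\boldsymbol{\mu}_k^* )$ is unique up to the numbering of the means; (b) for all $j\ne l\in\{1,\ldots,k\}$: $P\{\|\mathbf{X}-\boldsymbol{\mu}_j^*\|^2=\|\mathbf{X}-\boldsymbol{\mu}_l^*\|^2\}=0$; (c) $\tilde P\left\{\lim_{n\to\infty}T_n^m(\mathbf{X}_1,\ldots,\mathbf{X}_n)=W(P)\mid \mathbf{G}=\boldsymbol{\gamma}\right\}=1$. For $\theta=(P,\boldsymbol{\gamma})\in\Theta$ consider the fixed classification model associated to $P$, in which $\mathbf{X}_1,\mathbf{X}_2,\ldots$ are independent with ${\cal L}(\mathbf{X}_i)=P_{\gamma_i}$, $i\in\mathbb{N}$. Then the parameters $\gamma_i$, $i\in\mathbb{N}$, are empirically identifiable: for every $i\in\mathbb{N}$ there is a sequence of estimators $G_n$ (functions of $(\mathbf{X}_1,\ldots,\mathbf{X}_n)$ with values in $\{1,\ldots,k\}$) such that for all $\theta=(P,\boldsymbol{\gamma})\in\Theta$, $G_n(\mathbf{X}_1,\ldots,\mathbf{X}_n)\to\gamma_i$ in probability under this model.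
   Context: For a distribution $P$ on $\mathbb{R}^p$ define \[ W(P)=(\boldsymbol{\mu}_1^*,\ldots,\boldsymbol{\mu}_k^* )=\arg\min_{(\mathbf{m}_1,\ldots,\mathbf{m}_k)\in(\mathbb{R}^p)^k}\int\min_{\mathbf{m}\in\{\mathbf{m}_1,\ldots,\mathbf{m}_k\}}\|\mathbf{x}-\mathbf{m}\|^2\,dP(\mathbf{x}), \] where the means are numbered in lexicographic order (increasingly by first coordinate, ties broken by the second coordinate, and so on). For $\mathbf{X}$ with law $P$ and $j=1,\ldots,k$ define \[ A_j=\{\mathbf{x}\in\mathbb{R}^p:\ j=\arg\min_l\|\mathbf{x}-\boldsymbol{\mu}_l^*\|^2\},\quad P_j={\cal L}(\mathbf{X}\mid\mathbf{X}\in A_j),\quad \pi_j=P(A_j), \] so that $P=\sum_{j=1}^k\pi_jP_j$. The $k$-means estimator $T_n^m(\mathbf{X}_1,\ldots,\mathbf{X}_n)=(\mathbf{m}_{1n},\ldots,\mathbf{m}_{kn})$ is a minimiser of $\sum_{i=1}^n\min_{j\in\{1,\ldots,k\}}\|\mathbf{X}_i-\mathbf{m}_j\|^2$ over $(\mathbf{m}_1,\ldots,\mathbf{m}_k)\in(\mathbb{R}^p)^k$, ties broken by an arbitrary fixed rule, with the means numbered in lexicographic order. $\tilde P$ is the law of an i.i.d. sequence $((G_1,\mathbf{X}_1),(G_2,\mathbf{X}_2),\ldots)$ where $G_i\in\{1,\ldots,k\}$ has a categorical distribution with probabilities $(\pi_1,\ldots,\pi_k)$ and ${\cal L}(\mathbf{X}_i\mid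 G_i=j)=P_j$; $\mathbf{G}=(G_1,G_2,\ldots)$. Conditionally on $\mathbf{G}=\boldsymbol{\gamma}$, the $\mathbf{X}_i$ are independent with ${\cal L}(\mathbf{X}_i)=P_{\gamma_i}$, and this product law is the meaning of the conditional probability in (c). Empirical identifiability: let observations on a space ${\cal X}$ have a joint distribution $P_{\infty;\theta}$, $\theta\in\Theta$, and let $g:\Theta\to\Lambda$ with $\Lambda$ a metric space. $g(\theta)$ is called empirically identifiable if there is a sequence of estimators $T_n:{\cal X}^n\to\Lambda$ such that for all $\theta\in\Theta$, $T_n(\mathbf{X}_1,\ldots,\mathbf{X}_n)\to g(\theta)$ in probability under $P_{\infty;\theta}$. Here $g(\theta)=\gamma_i$ and $\Lambda=\{1,\ldots,k\}$ carries the discrete metric. It is assumed throughout that all sets and functions involved (including the $k$-means estimator) are measurable. *)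

theory Defs
  imports "HOL-Probability.Probability" "HOL-Library.Fun_Lexorder"
begin

text \<open>
  Points of \<open>p\<close>-dimensional space are vectors of type \<open>real ^ 'p\<close>; the index type carries a linear
  order, which is the order of the coordinates in lexicographic comparisons.
  A tuple of \<open>k\<close> means is an element of \<open>{1..k} \<rightarrow>\<^sub>E UNIV\<close>.
  Infinite sequences, such as the observations, are indexed from 0, so the
  first \<open>n\<close> observations are an element of \<open>{..<n} \<rightarrow>\<^sub>E UNIV\<close>.
\<close>

definition lex_le :: "real ^ 'p::{finite,linorder} \<Rightarrow> real ^ 'p::{finite,linorder} \<Rightarrow> bool" where
  "lex_le x y \<longleftrightarrow> x = y \<or> less_fun (($) x) (($) y)"

definition lex_numbered :: "nat \<Rightarrow> (nat \<Rightarrow> real ^ 'p::{finite,linorder}) \<Rightarrow> bool" where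
  "lex_numbered k m \<longleftrightarrow> (\<forall>i\<in>{1..k}. \<forall>j\<in>{1..k}. i \<le> j \<longrightarrow> lex_le (m i) (m j))"

definition min_sqdist :: "nat \<Rightarrow> (nat \<Rightarrow> real ^ 'p) \<Rightarrow> real ^ 'p \<Rightarrow> real" where
  "min_sqdist k m x = (MIN j\<in>{1..k}. (norm (x - m j))\<^sup>2)"

definition kmeans_risk :: "nat \<Rightarrow> (real ^ 'p) measure \<Rightarrow> (nat \<Rightarrow> real ^ 'p) \<Rightarrow> ennreal" where
  "kmeans_risk k P m = (\<integral>\<^sup>+ x. ennreal (min_sqdist k m x) \<partial>P)"

definition is_kmeans_minimiser ::
    "nat \<Rightarrow> (real ^ 'p) measure \<Rightarrow> (nat \<Rightarrow> real ^ 'p) \<Rightarrow> bool" where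
  "is_kmeans_minimiser k P = is_arg_min (kmeans_risk k P) (\<lambda>m. m \<in> {1..k} \<rightarrow>\<^sub>E UNIV)"

definition unique_up_to_numbering :: "nat \<Rightarrow> (real ^ 'p) measure \<Rightarrow> bool" where
  "unique_up_to_numbering k P \<longleftrightarrow>
     (\<exists>m. is_kmeans_minimiser k P m \<and>
       (\<forall>m'. is_kmeans_minimiser k P m' \<longrightarrow>
         (\<exists>\<sigma>. \<sigma> permutes {1..k} \<and> (\<forall>j\<in>{1..k}. m' j = m (\<sigma> j)))))"

text \<open>The functional \<open>W\<close>; it is only meaningful under \<^const>\<open>unique_up_to_numbering\<close>.\<close>

definition kmeans_functional ::
    "nat \<Rightarrow> (real ^ 'p::{finite,linorder}) measure \<Rightarrow> nat \<Rightarrow> real ^ 'p::{finite,linorder}" where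
  "kmeans_functional k P = (THE m. is_kmeans_minimiser k P m \<and> lex_numbered k m)"

text \<open>
  The set \<open>A\<^sub>j\<close> of points whose closest mean is the \<open>j\<close>-th one. Points with several closest means
  belong to no cell.
\<close>

definition kmeans_cell ::
    "nat \<Rightarrow> (real ^ 'p::{finite,linorder}) measure \<Rightarrow> nat \<Rightarrow> (real ^ 'p::{finite,linorder}) set" where
  "kmeans_cell k P j =
     {x. \<forall>l\<in>{1..k}. l \<noteq> j \<longrightarrow>
        (norm (x - kmeans_functional k P j))\<^sup>2 < (norm (x - kmeans_functional k P l))\<^sup>2}"

text \<open>The component \<open>P\<^sub>j\<close>: the law of \<open>X\<close> conditionally on \<open>X \<in> A\<^sub>j\<close>.\<close>

definition kmeans_component ::
    "nat \<Rightarrow> (real ^ 'p::{finite,linorder}) measure \<Rightarrow> nat \<Rightarrow> (real ^ 'p::{finite,linorder}) measure" where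
  "kmeans_component k P j = uniform_measure P (kmeans_cell k P j)"

text \<open>
  The fixed classification model. It is also the law of the observations under \<open>P\<close>-tilde
  conditionally on \<open>G = \<gamma>\<close>.
\<close>

definition fixed_classification_model ::
    "nat \<Rightarrow> (real ^ 'p::{finite,linorder}) measure \<Rightarrow> (nat \<Rightarrow> nat) \<Rightarrow>
     (nat \<Rightarrow> real ^ 'p::{finite,linorder}) measure" where
  "fixed_classification_model k P \<gamma> = (\<Pi>\<^sub>M i\<in>UNIV. kmeans_component k P (\<gamma> i))"

text \<open>
  A \<open>k\<close>-means estimator; the choice of \<open>T\<close> encodes the rule by which ties between minimisers
  are broken.
\<close>

definition is_kmeans_estimator ::
    "nat \<Rightarrow> (nat \<Rightarrow> (nat \<Rightarrow> real ^ 'p::{finite,linorder}) \<Rightarrow> nat \<Rightarrow> real ^ 'p::{finite,linorder}) \<Rightarrow>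
     bool" where
  "is_kmeans_estimator k T \<longleftrightarrow>
     (\<forall>n. T n \<in> (\<Pi>\<^sub>M i\<in>{..<n}. borel) \<rightarrow>\<^sub>M (\<Pi>\<^sub>M j\<in>{1..k}. borel)) \<and>
     (\<forall>n. \<forall>x \<in> {..<n} \<rightarrow>\<^sub>E UNIV.
        is_arg_min (\<lambda>m. \<Sum>i<n. min_sqdist k m (x i)) (\<lambda>m. m \<in> {1..k} \<rightarrow>\<^sub>E UNIV) (T n x) \<and>
        lex_numbered k (T n x))"

definition kmeans_parameters ::
    "nat \<Rightarrow> (nat \<Rightarrow> (nat \<Rightarrow> real ^ 'p::{finite,linorder}) \<Rightarrow> nat \<Rightarrow> real ^ 'p::{finite,linorder}) \<Rightarrow>
     ((real ^ 'p::{finite,linorder}) measure \<times> (nat \<Rightarrow> nat)) set" where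
  "kmeans_parameters k T =
     {(P, \<gamma>).
        prob_space P \<and> sets P = sets borel \<and> (\<forall>i. \<gamma> i \<in> {1..k}) \<and>
        (integrable P (\<lambda>x. (norm x)\<^sup>2) \<and> unique_up_to_numbering k P) \<and>
        (\<forall>j\<in>{1..k}. \<forall>l\<in>{1..k}. j \<noteq> l \<longrightarrow>
           \<P>(x in P. (norm (x - kmeans_functional k P j))\<^sup>2
                     = (norm (x - kmeans_functional k P l))\<^sup>2) = 0) \<and>
        \<P>(\<omega> in fixed_classification_model k P \<gamma>.
             \<forall>j\<in>{1..k}. (\<lambda>n. T n (restrict \<omega> {..<n}) j) \<longlonglongrightarrow> kmeans_functional k P j) = 1}"

definition converges_in_probability ::
    "'w measure \<Rightarrow> ('l \<Rightarrow> 'l \<Rightarrow> real) \<Rightarrow> (nat \<Rightarrow> 'w \<Rightarrow> 'l) \<Rightarrow> 'l \<Rightarrow> bool" where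
  "converges_in_probability M d Y c \<longleftrightarrow>
     (\<forall>\<epsilon>>0. (\<lambda>n. \<P>(\<omega> in M. d (Y n \<omega>) c > \<epsilon>)) \<longlonglongrightarrow> 0)"

definition metric_borel :: "'l set \<Rightarrow> ('l \<Rightarrow> 'l \<Rightarrow> real) \<Rightarrow> 'l measure" where
  "metric_borel L d = sigma L {U. openin (Metric_space.mtopology L d) U}"

text \<open>
  Empirical identifiability of \<open>g \<theta>\<close>, where \<open>S\<close> is the observation space, \<open>Pinf \<theta>\<close> the joint
  distribution of the sequence of observations, and \<open>(L, d)\<close> the metric space in which \<open>g\<close> takes
  its values.
\<close>

definition empirically_identifiable ::
    "'x measure \<Rightarrow> ('t \<Rightarrow> (nat \<Rightarrow> 'x) measure) \<Rightarrow> 't set \<Rightarrow> 'l set \<Rightarrow> ('l \<Rightarrow> 'l \<Rightarrow> real) \<Rightarrow>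
     ('t \<Rightarrow> 'l) \<Rightarrow> bool" where
  "empirically_identifiable S Pinf \<Theta> L d g \<longleftrightarrow>
     (\<exists>T. (\<forall>n. T n \<in> (\<Pi>\<^sub>M i\<in>{..<n}. S) \<rightarrow>\<^sub>M metric_borel L d) \<and>
          (\<forall>\<theta>\<in>\<Theta>. converges_in_probability (Pinf \<theta>) d
                   (\<lambda>n \<omega>. T n (restrict \<omega> {..<n})) (g \<theta>)))"

end

theory Submission
  imports Defs
begin

text \<open>
  Assign observation \<open>i\<close> to the nearest of the \<open>k\<close> estimated means. If the cell of some component of
  \<open>W(P)\<close> had probability 0, that mean could be moved anywhere without increasing the risk, against
  uniqueness; hence every \<open>P\<^sub>j\<close> is a probability measure concentrated on its open cell \<open>A\<^sub>j\<close>. So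
  almost surely the true mean of index \<open>\<gamma> i\<close> is strictly the closest to \<open>X\<^sub>i\<close>, and the
  same is true of the estimated means as soon as they are close enough to \<open>W(P)\<close>.
\<close>

section \<open>Lexicographic order and renumbering of the means\<close>

lemma linorder_lex_le:
  "class.linorder lex_le (\<lambda>x y :: real ^ 'p::{finite,linorder}. less_fun (($) x) (($) y))"
proof
  fix x y z :: "real ^ 'p::{finite,linorder}"
  show "less_fun (($) x) (($) y) \<longleftrightarrow> lex_le x y \<and> \<not> lex_le y x"
    by (auto simp: lex_le_def less_fun_irrefl dest: less_fun_asym)
  show "lex_le x x"
    by (simp add: lex_le_def)
  show "lex_le x z" if "lex_le x y" "lex_le y z"
    using that by (auto simp: lex_le_def intro: less_fun_trans)
  show "x = y" if "lex_le x y" "lex_le y x"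
    using that by (auto simp: lex_le_def dest: less_fun_asym)
  show "lex_le x y \<or> lex_le y x"
    using less_fun_trichotomy[of "($) x" "($) y"] by (auto simp: lex_le_def vec_eq_iff fun_eq_iff)
qed

interpretation lex: linorder lex_le "\<lambda>x y. less_fun (($) x) (($) y)"
  by (rule linorder_lex_le)

lemma lex_numbered_iff_sorted_wrt:
  "lex_numbered k m \<longleftrightarrow> sorted_wrt lex_le (map m [1..<Suc k])"
proof -
  \<comment> \<open>List positions start at 0 and means at 1, hence the \<open>Suc\<close>. The
    diagonal case that \<open>lex_numbered\<close> also covers is reflexivity.\<close>
  have "lex_numbered k m \<longleftrightarrow> (\<forall>i j. i < j \<longrightarrow> j < k \<longrightarrow> lex_le (m (Suc i)) (m (Suc j)))"
    (is "_ \<longleftrightarrow> ?R")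
  proof
    assume ?R
    show "lex_numbered k m"
      unfolding lex_numbered_def
    proof (intro ballI impI)
      fix i j assume "i \<in> {1..k}" "j \<in> {1..k}" "i \<le> j"
      then show "lex_le (m i) (m j)"
        using \<open>?R\<close>[rule_format, of "i - 1" "j - 1"] by (cases "i = j") auto
    qed
  qed (simp add: lex_numbered_def)
  then show ?thesis
    by (simp add: sorted_wrt_iff_nth_less del: upt_Suc)
qed

text \<open>The permutation makes the two lists of means equal as multisets, and a list sorted by a
  linear order is determined by its multiset of entries.\<close>

lemma lex_numbered_unique:
  assumes "\<sigma> permutes {1..k}" "\<forall>j\<in>{1..k}. m' j = m (\<sigma> j)"
    and "lex_numbered k m" "lex_numbered k m'" and "j \<in> {1..k}"
  shows "m' j = m j"
proof -
  have "image_mset m' (mset_set {1..k}) = image_mset (m \<circ> \<sigma>) (mset_set {1..k})"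
    using assms(2) by (intro image_mset_cong) auto
  also have "\<dots> = image_mset m (mset_set (\<sigma> ` {1..k}))"
    using permutes_inj_on[OF assms(1)]
    by (simp add: image_mset_mset_set flip: multiset.map_comp)
  also have "\<sigma> ` {1..k} = {1..k}"
    using assms(1) by (rule permutes_image)
  finally have "mset (map m' [1..<Suc k]) = mset (map m [1..<Suc k])"
    by (simp add: atLeastLessThanSuc_atLeastAtMost del: upt_Suc)
  then have "map m' [1..<Suc k] = map m [1..<Suc k]"
    using assms(3,4) lex.properties_for_sort unfolding lex_numbered_iff_sorted_wrt
    by metis
  then show ?thesis
    using assms(5) by (auto simp: atLeastLessThanSuc_atLeastAtMost simp del: upt_Suc)
qed

text \<open>The minimum only sees the set of means, so sorting a minimiser does not change its
  risk.\<close>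

lemma min_sqdist_cong_image:
  fixes m m' :: "nat \<Rightarrow> real ^ 'p"
  assumes "m ` {1..k} = m' ` {1..k}"
  shows "min_sqdist k m = min_sqdist k m'"
proof
  fix x :: "real ^ 'p"
  have "min_sqdist k f x = Min ((\<lambda>y. (norm (x - y))\<^sup>2) ` f ` {1..k})" for f
    by (simp add: min_sqdist_def image_image)
  then show "min_sqdist k m x = min_sqdist k m' x"
    using assms by simp
qed

section \<open>The functional W as a genuine minimiser\<close>

lemma is_kmeans_minimiser_mono:
  assumes "is_kmeans_minimiser k P m" "m' \<in> {1..k} \<rightarrow>\<^sub>E UNIV"
    and "kmeans_risk k P m' \<le> kmeans_risk k P m"
  shows "is_kmeans_minimiser k P m'"
  using assms unfolding is_kmeans_minimiser_def is_arg_min_def by (meson less_le_trans)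

text \<open>This justifies the definite description: sorting any minimiser gives a numbered one, and
  two numbered minimisers differ by a permutation, hence agree.\<close>

lemma kmeans_functional_minimiser:
  fixes P :: "(real ^ 'p::{finite,linorder}) measure"
  assumes "unique_up_to_numbering k P"
  shows "is_kmeans_minimiser k P (kmeans_functional k P)"
proof -
  obtain m where m: "is_kmeans_minimiser k P m"
    and u: "\<And>m'. is_kmeans_minimiser k P m' \<Longrightarrow>
         (\<exists>\<sigma>. \<sigma> permutes {1..k} \<and> (\<forall>j\<in>{1..k}. m' j = m (\<sigma> j)))"
    using assms unfolding unique_up_to_numbering_def by blast
  define ys where "ys = lex.sort (map m [1..<Suc k])"
  define w where "w = (\<lambda>j\<in>{1..k}. ys ! (j - 1))"
  have [simp]: "length ys = k"
    by (simp add: ys_def del: upt_Suc)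
  have "map w [1..<Suc k] = ys"
    by (rule nth_equalityI) (auto simp: w_def simp del: upt_Suc)
  moreover have "sorted_wrt lex_le ys"
    unfolding ys_def by (rule lex.sorted_sort)
  ultimately have lw: "lex_numbered k w"
    by (simp add: lex_numbered_iff_sorted_wrt)
  have "w ` {1..k} = set (map w [1..<Suc k])"
    by (simp add: atLeastLessThanSuc_atLeastAtMost del: upt_Suc)
  also have "\<dots> = m ` {1..k}"
    unfolding \<open>map w _ = ys\<close> ys_def by (simp add: atLeastLessThanSuc_atLeastAtMost del: upt_Suc)
  finally have "kmeans_risk k P w = kmeans_risk k P m"
    unfolding kmeans_risk_def by (metis min_sqdist_cong_image)
  moreover have "w \<in> {1..k} \<rightarrow>\<^sub>E UNIV"
    by (simp add: w_def)
  ultimately have mw: "is_kmeans_minimiser k P w"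
    by (intro is_kmeans_minimiser_mono[OF m]) simp_all
  have "kmeans_functional k P = w"
    unfolding kmeans_functional_def
  proof (rule the_equality)
    show "is_kmeans_minimiser k P w \<and> lex_numbered k w"
      using mw lw ..
  next
    fix v assume v: "is_kmeans_minimiser k P v \<and> lex_numbered k v"
    obtain \<sigma> \<tau> where \<sigma>: "\<sigma> permutes {1..k}" "\<forall>j\<in>{1..k}. v j = m (\<sigma> j)"
      and \<tau>: "\<tau> permutes {1..k}" "\<forall>j\<in>{1..k}. w j = m (\<tau> j)"
      using u v mw by metis
    \<comment> \<open>Both \<open>v\<close> and \<open>w\<close> are renumberings of
      \<open>m\<close>, so undoing \<open>\<tau>\<close> after \<open>\<sigma>\<close> turns one
      into the other.\<close>
    have "v j = w ((inv \<tau> \<circ> \<sigma>) j)" if "j \<in> {1..k}" for j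
    proof -
      have "inv \<tau> (\<sigma> j) \<in> {1..k}"
        using that \<sigma>(1) permutes_inv[OF \<tau>(1)] by (metis permutes_in_image)
      then show ?thesis
        using that \<sigma> \<tau> by (simp add: permutes_inverses)
    qed
    then have "v j = w j" if "j \<in> {1..k}" for j
      using permutes_compose[OF \<sigma>(1) permutes_inv[OF \<tau>(1)]] lw v that
      by (intro lex_numbered_unique) auto
    \<comment> \<open>Outside the index range both are \<open>undefined\<close>, so agreement on the
      range gives equality of functions.\<close>
    moreover have "v \<in> {1..k} \<rightarrow>\<^sub>E UNIV" "w \<in> {1..k} \<rightarrow>\<^sub>E UNIV"
      using v mw by (auto simp: is_kmeans_minimiser_def is_arg_min_def)
    ultimately show "v = w"
      by (metis PiE_ext)
  qed
  then show ?thesis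
    using mw by simp
qed

section \<open>Cells of the optimal means and their probabilities\<close>

lemma sets_kmeans_cell:
  assumes "sets P = sets borel"
  shows "kmeans_cell k P j \<in> sets P"
proof -
  have "{x \<in> space borel. \<forall>l\<in>{1..k}. l \<noteq> j \<longrightarrow>
        (norm (x - kmeans_functional k P j))\<^sup>2 < (norm (x - kmeans_functional k P l))\<^sup>2} \<in> sets borel"
    by measurable
  then show ?thesis
    by (simp add: kmeans_cell_def assms)
qed

lemma emeasure_kmeans_cell_nonzero:
  fixes P :: "(real ^ 'p::{finite,linorder}) measure"
  assumes P: "sets P = sets borel" and u: "unique_up_to_numbering k P" and j: "j \<in> {1..k}"
  shows "emeasure P (kmeans_cell k P j) \<noteq> 0"
proof
  assume null: "emeasure P (kmeans_cell k P j) = 0"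
  define m where "m = kmeans_functional k P"
  have m: "is_kmeans_minimiser k P m"
    unfolding m_def using u by (rule kmeans_functional_minimiser)
  \<comment> \<open>The new position \<open>y\<close> must differ from all current means, so that
    moving mean \<open>j\<close> there changes the set of means.\<close>
  have "infinite (UNIV :: (real ^ 'p::{finite,linorder}) set)"
    using finite_imp_bounded not_bounded_UNIV by blast
  then obtain y where y: "y \<notin> m ` {1..k}"
    using ex_new_if_finite by blast
  define m' where "m' = m(j := y)"
  have "kmeans_risk k P m' \<le> kmeans_risk k P m"
    unfolding kmeans_risk_def
  proof (rule nn_integral_mono_AE)
    have "AE x in P. x \<notin> kmeans_cell k P j"
      using null by (intro AE_not_in) (simp add: null_sets_def sets_kmeans_cell[OF P])
    then show "AE x in P. ennreal (min_sqdist k m' x) \<le> ennreal (min_sqdist k m x)"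
    proof eventually_elim
      case (elim x)
      \<comment> \<open>Off the cell of \<open>j\<close>, another mean \<open>l\<close> is at least
        as close as mean \<open>j\<close>. It keeps its place in \<open>m'\<close> and stands in for
        mean \<open>j\<close> in the minimum.\<close>
      then obtain l where l: "l \<in> {1..k}" "l \<noteq> j" "(norm (x - m l))\<^sup>2 \<le> (norm (x - m j))\<^sup>2"
        by (auto simp: kmeans_cell_def m_def not_less)
      have min: "min_sqdist k m' x \<le> (norm (x - m i))\<^sup>2" if "i \<in> {1..k}" "i \<noteq> j" for i
        unfolding min_sqdist_def using that by (intro Min_le) (auto simp: m'_def image_iff)
      have "min_sqdist k m' x \<le> (norm (x - m i))\<^sup>2" if "i \<in> {1..k}" for i
        using min[of i] order_trans[OF min[OF l(1,2)] l(3)] that by (cases "i = j") auto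
      then have "min_sqdist k m' x \<le> min_sqdist k m x"
        unfolding min_sqdist_def[of k m] using j by (subst Min_ge_iff) auto
      then show ?case
        by (rule ennreal_leI)
    qed
  qed
  moreover have "m' \<in> {1..k} \<rightarrow>\<^sub>E UNIV"
    using m j by (auto simp: m'_def is_kmeans_minimiser_def is_arg_min_def PiE_iff extensional_def)
  ultimately have m': "is_kmeans_minimiser k P m'"
    using m by (blast intro: is_kmeans_minimiser_mono)
  obtain m0 where m0: "\<And>m'. is_kmeans_minimiser k P m' \<Longrightarrow>
         (\<exists>\<sigma>. \<sigma> permutes {1..k} \<and> (\<forall>j\<in>{1..k}. m' j = m0 (\<sigma> j)))"
    using u unfolding unique_up_to_numbering_def by blast
  \<comment> \<open>Uniqueness up to numbering forces all minimisers to have the same set of means,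
    whereas only \<open>m'\<close> contains \<open>y\<close>.\<close>
  have "f ` {1..k} = m0 ` {1..k}" if f: "is_kmeans_minimiser k P f" for f
  proof -
    obtain \<sigma> where \<sigma>: "\<sigma> permutes {1..k}" "\<forall>j\<in>{1..k}. f j = m0 (\<sigma> j)"
      using m0[OF f] by blast
    have "f ` {1..k} = m0 ` \<sigma> ` {1..k}"
      using \<sigma>(2) by (auto simp: image_iff)
    then show ?thesis
      using permutes_image[OF \<sigma>(1)] by simp
  qed
  then have "m' ` {1..k} = m ` {1..k}"
    using m m' by simp
  moreover have "y \<in> m' ` {1..k}"
    using j by (auto simp: m'_def)
  ultimately show False
    using y by simp
qed

section \<open>Choosing the nearest mean\<close>

definition nearest_index :: "nat \<Rightarrow> (nat \<Rightarrow> 'a::real_normed_vector) \<Rightarrow> 'a \<Rightarrow> nat" where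
  "nearest_index k m x = (LEAST j. j \<in> {1..k} \<and> (\<forall>l\<in>{1..k}. norm (x - m j) \<le> norm (x - m l)))"

lemma nearest_index_in:
  assumes "k > 0"
  shows "nearest_index k m x \<in> {1..k}"
proof -
  have "\<exists>j. is_arg_min (\<lambda>j. norm (x - m j)) (\<lambda>j. j \<in> {1..k}) j"
    using assms by (intro ex_is_arg_min_if_finite) auto
  then have "\<exists>j. j \<in> {1..k} \<and> (\<forall>l\<in>{1..k}. norm (x - m j) \<le> norm (x - m l))"
    by (auto simp: is_arg_min_linorder)
  from LeastI_ex[OF this] show ?thesis
    by (simp add: nearest_index_def)
qed

lemma nearest_index_eqI:
  assumes "j \<in> {1..k}" "\<And>l. l \<in> {1..k} \<Longrightarrow> l \<noteq> j \<Longrightarrow> norm (x - m j) < norm (x - m l)"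
  shows "nearest_index k m x = j"
  unfolding nearest_index_def
proof (rule Least_equality)
  show "j \<in> {1..k} \<and> (\<forall>l\<in>{1..k}. norm (x - m j) \<le> norm (x - m l))"
    using assms by (metis less_eq_real_def)
  show "j \<le> i" if "i \<in> {1..k} \<and> (\<forall>l\<in>{1..k}. norm (x - m i) \<le> norm (x - m l))" for i
    using assms that by (metis not_less order_refl)
qed

text \<open>Being strictly nearest amounts to finitely many strict inequalities between continuous
  functions of the means, so it survives small perturbations of them.\<close>

lemma eventually_nearest_index_eq:
  assumes "j \<in> {1..k}" "\<And>l. l \<in> {1..k} \<Longrightarrow> l \<noteq> j \<Longrightarrow> norm (x - m j) < norm (x - m l)"
    and lim: "\<And>l. l \<in> {1..k} \<Longrightarrow> ((\<lambda>n. M n l) \<longlongrightarrow> m l) F"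
  shows "\<forall>\<^sub>F n in F. nearest_index k (M n) x = j"
proof -
  have "\<forall>\<^sub>F n in F. norm (x - M n j) < norm (x - M n l)" if "l \<in> {1..k} - {j}" for l
  proof -
    have "((\<lambda>n. norm (x - M n l) - norm (x - M n j)) \<longlongrightarrow> norm (x - m l) - norm (x - m j)) F"
      using assms(1) that by (intro tendsto_intros lim) auto
    then have "\<forall>\<^sub>F n in F. 0 < norm (x - M n l) - norm (x - M n j)"
      using assms(2) that by (intro order_tendstoD(1)) auto
    then show ?thesis
      by eventually_elim simp
  qed
  then have "\<forall>\<^sub>F n in F. \<forall>l\<in>{1..k} - {j}. norm (x - M n j) < norm (x - M n l)"
    by (intro eventually_ball_finite) auto
  then show ?thesis
    by eventually_elim (use assms(1) in \<open>auto intro!: nearest_index_eqI\<close>)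
qed

text \<open>Breaking ties by the least index keeps the choice measurable: each candidate is tested
  by finitely many comparisons of norms.\<close>

lemma measurable_nearest_index:
  fixes f :: "'a \<Rightarrow> nat \<Rightarrow> 'b::{real_normed_vector, second_countable_topology}"
  assumes [measurable]: "g \<in> borel_measurable M" "\<And>j. j \<in> {1..k} \<Longrightarrow> (\<lambda>x. f x j) \<in> borel_measurable M"
  shows "(\<lambda>x. nearest_index k (f x) (g x)) \<in> M \<rightarrow>\<^sub>M count_space UNIV"
proof -
  have "Measurable.pred M (\<lambda>x. j \<in> {1..k} \<and> (\<forall>l\<in>{1..k}. norm (g x - f x j) \<le> norm (g x - f x l)))" for j
    by (cases "j \<in> {1..k}") (auto intro!: pred_intros_finite)
  then show ?thesis
    unfolding nearest_index_def by (rule measurable_Least)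
qed

section \<open>Discrete metric and convergence in probability\<close>

lemma metric_borel_discrete: "metric_borel L discrete_metric.dd = sigma L (Pow L)"
proof -
  \<comment> \<open>In the discrete topology every subset is open.\<close>
  have "{U. openin (Metric_space.mtopology L discrete_metric.dd) U} = Pow L"
    by (auto simp: discrete_metric.mtopology_discrete_metric)
  then show ?thesis
    by (simp add: metric_borel_def)
qed

lemma (in finite_measure) tendsto_measure_0_AE:
  assumes [measurable]: "\<And>n. A n \<in> sets M" and "AE x in M. \<forall>\<^sub>F n in sequentially. x \<notin> A n"
  shows "(\<lambda>n. measure M (A n)) \<longlonglongrightarrow> 0"
proof -
  \<comment> \<open>The indicators are bounded by 1, which is integrable for a finite measure, and
    are eventually 0 at almost every point.\<close>
  have "(\<lambda>n. \<integral>x. indicator (A n) x \<partial>M) \<longlonglongrightarrow> (\<integral>x. (0::real) \<partial>M)"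
  proof (rule integral_dominated_convergence[where w = "\<lambda>_. 1"])
    show "AE x in M. (\<lambda>n. indicator (A n) x :: real) \<longlonglongrightarrow> 0"
      using assms(2)
    proof eventually_elim
      case (elim x)
      then show ?case
        by (intro tendsto_eventually) (auto elim: eventually_mono)
    qed
  qed (auto simp: indicator_def)
  then show ?thesis
    by (simp add: measure_def)
qed

section \<open>Consistency of the nearest-mean classifier\<close>

theorem theorem6p2:
  fixes k :: nat
    and T :: "nat \<Rightarrow> (nat \<Rightarrow> real ^ 'p::{finite,linorder}) \<Rightarrow> nat \<Rightarrow> real ^ 'p::{finite,linorder}"
  assumes "k > 1"
    and "is_kmeans_estimator k T"
  shows "\<forall>i. empirically_identifiable borel
               (\<lambda>(P, \<gamma>). fixed_classification_model k P \<gamma>)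
               (kmeans_parameters k T)
               {1..k} discrete_metric.dd
               (\<lambda>(P, \<gamma>). \<gamma> i)"
proof
  fix i
  \<comment> \<open>While \<open>n \<le> i\<close>, observation \<open>i\<close> is not yet
    available. The value 1 is an arbitrary label that keeps \<open>G\<close> inside the label
    set.\<close>
  define G where "G n x = (if i < n then nearest_index k (T n x) (x i) else 1)" for n x
  have T_meas: "T n \<in> (\<Pi>\<^sub>M i\<in>{..<n}. borel) \<rightarrow>\<^sub>M (\<Pi>\<^sub>M j\<in>{1..k}. borel)" for n
    using assms(2) by (simp add: is_kmeans_estimator_def)
  have G_meas: "G n \<in> (\<Pi>\<^sub>M i\<in>{..<n}. borel) \<rightarrow>\<^sub>M count_space UNIV" for n
  proof (cases "i < n")
    case True
    have "(\<lambda>x. nearest_index k (T n x) (x i)) \<in> (\<Pi>\<^sub>M i\<in>{..<n}. borel) \<rightarrow>\<^sub>M count_space UNIV"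
    proof (rule measurable_nearest_index)
      show "(\<lambda>x. x i) \<in> borel_measurable (\<Pi>\<^sub>M i\<in>{..<n}. borel)"
        using True by (intro measurable_component_singleton) simp
      show "(\<lambda>x. T n x j) \<in> borel_measurable (\<Pi>\<^sub>M i\<in>{..<n}. borel)" if "j \<in> {1..k}" for j
        using measurable_compose[OF T_meas measurable_component_singleton[OF that]] .
    qed
    then show ?thesis
      using True by (simp add: G_def[abs_def])
  qed (simp add: G_def[abs_def])
  have G_in: "G n x \<in> {1..k}" for n x
    using nearest_index_in[of k "T n x" "x i"] assms(1) by (auto simp: G_def)
  have "G n \<in> (\<Pi>\<^sub>M i\<in>{..<n}. borel) \<rightarrow>\<^sub>M metric_borel {1..k} discrete_metric.dd" for n
  proof (rule measurableI)
    show "G n -` A \<inter> space (\<Pi>\<^sub>M i\<in>{..<n}. borel) \<in> sets (\<Pi>\<^sub>M i\<in>{..<n}. borel)" for A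
      using measurable_sets[OF G_meas, of A n] by simp
  qed (use G_in in \<open>simp add: metric_borel_discrete\<close>)
  moreover have "converges_in_probability (fixed_classification_model k P \<gamma>) discrete_metric.dd
      (\<lambda>n \<omega>. G n (restrict \<omega> {..<n})) (\<gamma> i)"
    if "(P, \<gamma>) \<in> kmeans_parameters k T" for P \<gamma>
  proof -
    define \<mu> where "\<mu> = kmeans_functional k P"
    define M where "M = fixed_classification_model k P \<gamma>"
    have P: "prob_space P" "sets P = sets borel" "unique_up_to_numbering k P" and \<gamma>: "\<gamma> j \<in> {1..k}" for j
      using that by (auto simp: kmeans_parameters_def)
    interpret P: prob_space P by fact
    \<comment> \<open>Positive cell probability is what makes conditioning on the cell yield a
      probability measure, and hence the model a product of probability measures.\<close>
    have comp: "prob_space (kmeans_component k P (\<gamma> j))" for j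
      unfolding kmeans_component_def using emeasure_kmeans_cell_nonzero[OF P(2,3) \<gamma>]
      by (intro prob_space_uniform_measure) auto
    have "sets M = sets (\<Pi>\<^sub>M j\<in>UNIV. borel)"
      unfolding M_def fixed_classification_model_def
      by (intro sets_PiM_cong) (simp_all add: kmeans_component_def P(2))
    note [measurable_cong] = this
    interpret M: prob_space M
      unfolding M_def fixed_classification_model_def by (intro prob_space_PiM comp)
    \<comment> \<open>Coordinate \<open>i\<close> has law
      \<open>kmeans_component k P (\<gamma> i)\<close>, which is concentrated on the cell with label
      \<open>\<gamma> i\<close>.\<close>
    have "AE \<omega> in M. \<omega> i \<in> kmeans_cell k P (\<gamma> i)"
      unfolding M_def fixed_classification_model_def
    proof (rule AE_PiM_component[OF comp])
      show "AE x in kmeans_component k P (\<gamma> i). x \<in> kmeans_cell k P (\<gamma> i)"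
        unfolding kmeans_component_def by (intro AE_uniform_measureI sets_kmeans_cell P) simp
    qed simp
    moreover have "AE \<omega> in M. \<forall>j\<in>{1..k}. (\<lambda>n. T n (restrict \<omega> {..<n}) j) \<longlonglongrightarrow> \<mu> j"
    proof -
      \<comment> \<open>This is assumption (c): the model is also the conditional law given the
        labels.\<close>
      have "\<P>(\<omega> in M. \<forall>j\<in>{1..k}. (\<lambda>n. T n (restrict \<omega> {..<n}) j) \<longlonglongrightarrow> \<mu> j) = 1"
        using that by (simp add: kmeans_parameters_def M_def \<mu>_def)
      from M.AE_prob_1[OF this] show ?thesis
        by eventually_elim simp
    qed
    ultimately have ae: "AE \<omega> in M. \<forall>\<^sub>F n in sequentially. G n (restrict \<omega> {..<n}) = \<gamma> i"
    proof eventually_elim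
      case (elim \<omega>)
      have "\<forall>\<^sub>F n in sequentially. nearest_index k (T n (restrict \<omega> {..<n})) (\<omega> i) = \<gamma> i"
      proof (rule eventually_nearest_index_eq[OF \<gamma>])
        show "norm (\<omega> i - \<mu> (\<gamma> i)) < norm (\<omega> i - \<mu> l)" if "l \<in> {1..k}" "l \<noteq> \<gamma> i" for l
        \<comment> \<open>Cells compare squared distances, \<open>nearest_index\<close> plain
          ones.\<close>
        proof (rule power_less_imp_less_base)
          show "(norm (\<omega> i - \<mu> (\<gamma> i)))\<^sup>2 < (norm (\<omega> i - \<mu> l))\<^sup>2"
            using elim(1) that by (simp add: kmeans_cell_def \<mu>_def)
        qed simp
      qed (use elim(2) in blast)
      then show ?case
        using eventually_gt_at_top[of i] by eventually_elim (simp add: G_def)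
    qed
    have [measurable]: "(\<lambda>\<omega>. G n (restrict \<omega> {..<n})) \<in> M \<rightarrow>\<^sub>M count_space UNIV" for n
      by (rule measurable_compose[OF _ G_meas]) measurable
    show ?thesis
      unfolding converges_in_probability_def M_def[symmetric]
    proof (intro allI impI M.tendsto_measure_0_AE)
      fix \<epsilon> :: real assume "\<epsilon> > 0"
      \<comment> \<open>The discrete metric vanishes once the label is right, so the exceptional
        events eventually exclude almost every outcome.\<close>
      show "AE \<omega> in M. \<forall>\<^sub>F n in sequentially.
          \<omega> \<notin> {\<omega> \<in> space M. discrete_metric.dd (G n (restrict \<omega> {..<n})) (\<gamma> i) > \<epsilon>}"
        using ae
      proof eventually_elim
        case (elim \<omega>)
        then show ?case
          by eventually_elim (use \<open>\<epsilon> > 0\<close> in \<open>simp add: discrete_metric.dd_def\<close>)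
      qed
    qed measurable
  qed
  ultimately show "empirically_identifiable borel (\<lambda>(P, \<gamma>). fixed_classification_model k P \<gamma>)
      (kmeans_parameters k T) {1..k} discrete_metric.dd (\<lambda>(P, \<gamma>). \<gamma> i)"
    unfolding empirically_identifiable_def by (intro exI[of _ G]) auto
qed

end
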